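(* Let $S,O$ be sets, $\iota_S:S\to(0,\infty)$ and $\iota_O:O\to(0,\infty)$ maps, $c:S\times O\to[0,\infty)$ the ratio-induced cost $c(s,o)=J(\iota_S(s)/\iota_O(o))$, and $\mathcal C:S\times O\to\mathbb{R}$ a certificate (an arbitrary function). Assume: (H1) for all $s_1,s_2\in S$ and $o_1,o_2\in O$, $c(s_1,o_1)=c(s_2,o_2)$ implies $\mathcal C(s_1,o_1)=\mathcal C(s_2,o_2)$; (H2) for all $s_1,s_2\in S$ and $o\in O$, $\mathcal C(s_1,o)=\mathcal C(s_2,o)$. Fix $s_\ast\in S$ and let $\mathcal I_c:=\{r\in\mathbb{R}:\exists s\in S,\exists o\in O,\ r=c(s,o)\}$. Then: (a) there exists a unique map $\phi:\mathcal I_c\to\mathbb{R}$ such that $\mathcal C(s,o)=\phi(c(s,o))$ for all $s\in S$, $o\in O$; (b) there exists a unique map $\psi:O\to\mathbb{R}$ such that $\mathcal C(s,o)=\psi(o)$ for all $s\in S$, $o\in O$.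
   Context: $J(x):=\frac12(x+x^{-1})-1$ for $x>0$. *)

theory Defs
  imports Complex_Main "HOL-Library.FuncSet"
begin

text \<open>Only the values at \<open>x > 0\<close> are meaningful.\<close>

definition J :: "real \<Rightarrow> real" where
  "J x = (x + inverse x) / 2 - 1"

definition ratio_cost :: "('s \<Rightarrow> real) \<Rightarrow> ('o \<Rightarrow> real) \<Rightarrow> 's \<Rightarrow> 'o \<Rightarrow> real" where
  "ratio_cost \<iota>S \<iota>O s w = J (\<iota>S s / \<iota>O w)"

definition cost_image :: "'s set \<Rightarrow> 'o set \<Rightarrow> ('s \<Rightarrow> 'o \<Rightarrow> real) \<Rightarrow> real set" where
  "cost_image S Ob c = {r. \<exists>s\<in>S. \<exists>w\<in>Ob. r = c s w}"

end

theory Submission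
  imports Defs
begin

text \<open>
  Both parts are one fact about functions: a map that is constant on the fibres of \<open>p\<close> factors
  through \<open>p\<close>, and the factor is unique once its domain is the image of \<open>p\<close>. Applied on
  \<open>S \<times> Ob\<close> to the cost, whose fibre condition is (H1), it gives \<open>\<phi>\<close>; applied to the second
  projection, whose fibre condition is (H2), it gives \<open>\<psi>\<close>. The point \<open>s0\<close> ensures that the second
  projection maps onto \<open>Ob\<close>, without which \<open>\<psi>\<close> would be unconstrained.
\<close>

text \<open>The factor sends a point of the image to the value of \<open>f\<close> at any chosen preimage. Extensional
  functions turn uniqueness on the image into equality of total functions.\<close>

lemma ex1_factor_through_image:
  assumes fibres: "\<And>x y. x \<in> A \<Longrightarrow> y \<in> A \<Longrightarrow> p x = p y \<Longrightarrow> f x = f y"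
  shows "\<exists>!g. g \<in> p ` A \<rightarrow>\<^sub>E UNIV \<and> (\<forall>x\<in>A. f x = g (p x))"
proof (rule ex_ex1I)
  have "f x = f (inv_into A p (p x))" if "x \<in> A" for x
    using that by (intro fibres) (auto simp: inv_into_into f_inv_into_f)
  then show "\<exists>g. g \<in> p ` A \<rightarrow>\<^sub>E UNIV \<and> (\<forall>x\<in>A. f x = g (p x))"
    by (intro exI[of _ "restrict (f \<circ> inv_into A p) (p ` A)"]) auto
next
  fix g h
  assume g: "g \<in> p ` A \<rightarrow>\<^sub>E UNIV \<and> (\<forall>x\<in>A. f x = g (p x))"
    and h: "h \<in> p ` A \<rightarrow>\<^sub>E UNIV \<and> (\<forall>x\<in>A. f x = h (p x))"
  show "g = h"
  proof (rule PiE_ext)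
    show "g \<in> p ` A \<rightarrow>\<^sub>E UNIV" "h \<in> p ` A \<rightarrow>\<^sub>E UNIV"
      using g h by auto
    show "g y = h y" if "y \<in> p ` A" for y
      using that g h by fastforce
  qed
qed

theorem theorem3p31:
  fixes S :: "'s set" and Ob :: "'o set"
    and \<iota>S :: "'s \<Rightarrow> real" and \<iota>O :: "'o \<Rightarrow> real"
    and C :: "'s \<Rightarrow> 'o \<Rightarrow> real" and s0 :: 's
  assumes "\<iota>S \<in> S \<rightarrow> {0<..}"
    and "\<iota>O \<in> Ob \<rightarrow> {0<..}"
    and H1: "\<forall>s1\<in>S. \<forall>s2\<in>S. \<forall>w1\<in>Ob. \<forall>w2\<in>Ob.
          ratio_cost \<iota>S \<iota>O s1 w1 = ratio_cost \<iota>S \<iota>O s2 w2 \<longrightarrow> C s1 w1 = C s2 w2"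
    and H2: "\<forall>s1\<in>S. \<forall>s2\<in>S. \<forall>w\<in>Ob. C s1 w = C s2 w"
    and "s0 \<in> S"
  shows "(\<exists>!\<phi>. \<phi> \<in> cost_image S Ob (ratio_cost \<iota>S \<iota>O) \<rightarrow>\<^sub>E (UNIV :: real set) \<and>
            (\<forall>s\<in>S. \<forall>w\<in>Ob. C s w = \<phi> (ratio_cost \<iota>S \<iota>O s w))) \<and>
         (\<exists>!\<psi>. \<psi> \<in> Ob \<rightarrow>\<^sub>E (UNIV :: real set) \<and>
            (\<forall>s\<in>S. \<forall>w\<in>Ob. C s w = \<psi> w))"
proof
  let ?c = "ratio_cost \<iota>S \<iota>O"
  have image: "(\<lambda>(s, w). ?c s w) ` (S \<times> Ob) = cost_image S Ob ?c"
    by (auto simp: cost_image_def)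
  have "\<exists>!\<phi>. \<phi> \<in> (\<lambda>(s, w). ?c s w) ` (S \<times> Ob) \<rightarrow>\<^sub>E UNIV \<and>
      (\<forall>x\<in>S \<times> Ob. (\<lambda>(s, w). C s w) x = \<phi> ((\<lambda>(s, w). ?c s w) x))"
  proof (rule ex1_factor_through_image)
    fix x y
    assume "x \<in> S \<times> Ob" "y \<in> S \<times> Ob" and "(\<lambda>(s, w). ?c s w) x = (\<lambda>(s, w). ?c s w) y"
    then show "(\<lambda>(s, w). C s w) x = (\<lambda>(s, w). C s w) y"
      by (cases x, cases y) (simp, metis H1)
  qed
  then show "\<exists>!\<phi>. \<phi> \<in> cost_image S Ob ?c \<rightarrow>\<^sub>E (UNIV :: real set) \<and>
      (\<forall>s\<in>S. \<forall>w\<in>Ob. C s w = \<phi> (?c s w))"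
    unfolding image by simp
next
  have image: "snd ` (S \<times> Ob) = Ob"
    using \<open>s0 \<in> S\<close> by force
  have "\<exists>!\<psi>. \<psi> \<in> snd ` (S \<times> Ob) \<rightarrow>\<^sub>E UNIV \<and>
      (\<forall>x\<in>S \<times> Ob. (\<lambda>(s, w). C s w) x = \<psi> (snd x))"
  proof (rule ex1_factor_through_image)
    fix x y
    assume "x \<in> S \<times> Ob" "y \<in> S \<times> Ob" and "snd x = snd y"
    then show "(\<lambda>(s, w). C s w) x = (\<lambda>(s, w). C s w) y"
      by (cases x, cases y) (simp, metis H2)
  qed
  then show "\<exists>!\<psi>. \<psi> \<in> Ob \<rightarrow>\<^sub>E (UNIV :: real set) \<and> (\<forall>s\<in>S. \<forall>w\<in>Ob. C s w = \<psi> w)"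
    unfolding image by simp
qed

end
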